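(* Let $a,b,c>0$ be real numbers with $a^2+b^2=c^2$, and put $$r_1=\tfrac12(a+b-c),\quad r_2=\tfrac12(a-b+c),\quad r_3=\tfrac12(-a+b+c),\quad r_4=\tfrac12(a+b+c).$$ Then $r_4=r_1+r_2+r_3$ and $r_2r_3=r_1r_4$. Moreover, the quadruple $[-r_1,r_2,r_3,r_4]$ satisfies the Descartes Circle Equation: $$(-r_1)^2+r_2^2+r_3^2+r_4^2=\tfrac12\,(-r_1+r_2+r_3+r_4)^2.$$
   Context: A quadruple $[k_1,k_2,k_3,k_4]$ of real numbers satisfies the Descartes Circle Equation if the sum of the squares of its entries is half the square of the sum of its entries. *)

theory Defs
  imports Complex_Main
begin

definition descartes_circle_equation :: "real \<Rightarrow> real \<Rightarrow> real \<Rightarrow> real \<Rightarrow> bool" where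
  "descartes_circle_equation k1 k2 k3 k4 \<longleftrightarrow>
     k1\<^sup>2 + k2\<^sup>2 + k3\<^sup>2 + k4\<^sup>2 = 1/2 * (k1 + k2 + k3 + k4)\<^sup>2"

end

theory Submission
  imports Defs
begin

text \<open>Everything reduces to polynomial identities in \<open>a\<close>, \<open>b\<close>,
  \<open>c\<close>. Both sides of the Descartes equation equal \<open>2 * c\<^sup>2\<close>: the
  squares sum to \<open>a\<^sup>2 + b\<^sup>2 + c\<^sup>2\<close>, and the signed sum is
  \<open>2 * c\<close>.\<close>

theorem mainTheorem7:
  fixes a b c r1 r2 r3 r4 :: real
  assumes "a > 0" and "b > 0" and "c > 0"
    and "a\<^sup>2 + b\<^sup>2 = c\<^sup>2"
    and "r1 = 1/2 * (a + b - c)"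
    and "r2 = 1/2 * (a - b + c)"
    and "r3 = 1/2 * (- a + b + c)"
    and "r4 = 1/2 * (a + b + c)"
  shows "r4 = r1 + r2 + r3 \<and> r2 * r3 = r1 * r4 \<and>
    descartes_circle_equation (- r1) r2 r3 r4 \<and>
    (- r1)\<^sup>2 + r2\<^sup>2 + r3\<^sup>2 + r4\<^sup>2 = 1/2 * (- r1 + r2 + r3 + r4)\<^sup>2"
proof -
  have "r4 = r1 + r2 + r3"
    using assms(5-8) by simp
  \<comment> \<open>As differences of squares, the sides are a quarter of
    \<open>c\<^sup>2 - (a - b)\<^sup>2\<close> and of
    \<open>(a + b)\<^sup>2 - c\<^sup>2\<close>.\<close>
  moreover have "r2 * r3 = r1 * r4"
    using assms(4) unfolding assms(5-8) by (simp add: power2_eq_square algebra_simps)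
  moreover have "(- r1)\<^sup>2 + r2\<^sup>2 + r3\<^sup>2 + r4\<^sup>2 = 1/2 * (- r1 + r2 + r3 + r4)\<^sup>2"
  proof -
    \<comment> \<open>Each mixed product occurs twice with each sign and cancels; the Pythagorean
      relation enters only afterwards.\<close>
    have "(- r1)\<^sup>2 + r2\<^sup>2 + r3\<^sup>2 + r4\<^sup>2 = a\<^sup>2 + b\<^sup>2 + c\<^sup>2"
      unfolding assms(5-8) by (simp add: power2_eq_square field_simps)
    also have "\<dots> = 1/2 * (2 * c)\<^sup>2"
      using assms(4) by (simp add: power_mult_distrib)
    also have "2 * c = - r1 + r2 + r3 + r4"
      unfolding assms(5-8) by (simp add: field_simps)
    finally show ?thesis .
  qed
  ultimately show ?thesis
    by (simp add: descartes_circle_equation_def)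
qed

end
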